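(* Let $(\mathcal{X},p_a(y|x),p_d(y|x),p_T(t),\mathcal{Y})$ be a channel that dies, where the discrete memoryless channel $p_a$ has zero-error capacity equal to zero. Then there is no positive integer $N$ and no $V>0$ such that $(N,V)$ is an achievable transmission time-volume at Shannon reliability.
   Context: Channel that dies: finite input alphabet $\mathcal{X}$, finite output alphabet $\mathcal{Y}$ containing an erasure symbol $?$. There are two states, alive ($a$) and dead ($d$). In state $a$ the channel acts as a noisy discrete memoryless channel $p_a(y|x)$ that never outputs $?$; in state $d$ it outputs $?$ with probability 1 whatever the input. The state is $a$ at times $n=1,\dots,T$ and $d$ at times $n=T+1,T+2,\dots$, where $T$ is a random positive integer with distribution $p_T$, independent of the inputs and of the channel noise. Codes: an $(M_i,n_i)_{i=1}^k$ code consists of message sets $\mathcal{W}_i=\{1,\dots,M_i\}$, encoders $f_i:\mathcal{W}_i\to\mathcal{X}^{n_i}$ and decoders $g_i:\mathcal{Y}^{n_i}\to\mathcal{W}_i\cup\{\ominus\}$, $i=1,\dots,k$. The codewords $f_1(W_1),\dots,f_k(W_k)$ of independent messages are sent consecutively, the $i$th one occupying channel times $e_{i-1}+1,\dots,e_i$, where $e_0=0$ and $e_i=n_1+\cdots+n_i$, and $\hat W_i=g_i(Y_{e_{i-1}+1},\dots,Y_{e_i})$. The symbol $\ominus$ denotes a declared erasure. Standing assumption on decoders: if none of the $n_i$ output symbols in block $i$ is $?$, then $g_i$ outputs an element of $\mathcal{W}_i$; if any of them is $?$, then $g_i$ outputs $\ominus$. Performance: $\lambda_w(i)=\Pr[\hat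 W_i\ne w\mid W_i=w,\hat W_i\neq\ominus]$, $\lambda_{\max}(i)=\max_{w\in\mathcal{W}_i}\lambda_w(i)$, $\lambda_{\max}=\max_{1\le i\le k}\lambda_{\max}(i)$. The transmission time is $N=\sum_{i=1}^k n_i$. The expected transmission volume is $V=\mathrm{E}_T\{\sum_{i:\hat W_i\ne\ominus}\log M_i\}$. For $0\le\eta<1$, a pair $(N_0,V_0)$, with $N_0$ a positive integer and $V_0\ge0$, is an achievable transmission time-volume at $\eta$-reliability if for some $k$ there is an $(M_i,n_i)_{i=1}^k$ code with $\lambda_{\max}\le\eta$, $N\le N_0$ and $V\ge V_0$. It is achievable at Shannon reliability if it is achievable at $\eta$-reliability for all $0<\eta<1$. *)

theory Defs
  imports "HOL-Probability.Probability" "HOL-Library.Monad_Syntax"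
begin

text \<open>
  The output of a memoryless channel with time-varying transition law \<open>p\<close> on the input word \<open>xs\<close>.
  Times are counted from 1: the letter \<open>xs ! j\<close> is sent at time \<open>Suc j\<close>.
\<close>

definition channel_output :: "(nat \<Rightarrow> 'x \<Rightarrow> 'y pmf) \<Rightarrow> 'x list \<Rightarrow> 'y list pmf" where
  "channel_output p xs =
     map_pmf (\<lambda>y. map y [0..<length xs])
       (Pi_pmf {..<length xs} undefined (\<lambda>j. p (Suc j) (xs ! j)))"

definition zero_error_code ::
  "('x \<Rightarrow> 'y pmf) \<Rightarrow> nat \<Rightarrow> nat \<Rightarrow> (nat \<Rightarrow> 'x list) \<Rightarrow> ('y list \<Rightarrow> nat) \<Rightarrow> bool" where
  "zero_error_code p M n f g \<longleftrightarrow>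
     (\<forall>w\<in>{1..M}. length (f w) = n) \<and>
     (\<forall>ys. length ys = n \<longrightarrow> g ys \<in> {1..M}) \<and>
     (\<forall>w\<in>{1..M}. \<P>(ys in channel_output (\<lambda>_. p) (f w). g ys \<noteq> w) = 0)"

text \<open>
  Over a finite input alphabet the set below is bounded above by \<open>log 2 CARD('x)\<close>; it contains
  the rate 0, so the supremum is a genuine one.
\<close>

definition zero_error_capacity :: "('x::finite \<Rightarrow> 'y::finite pmf) \<Rightarrow> real" where
  "zero_error_capacity p =
     Sup {log 2 (real M) / real n | M n. 1 \<le> M \<and> 1 \<le> n \<and> (\<exists>f g. zero_error_code p M n f g)}"

text \<open>
  Blocks are indexed by \<open>{1..num_blocks C}\<close> and the messages of block \<open>i\<close> by \<open>{1..num_msgs C i}\<close>;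
  the fields are irrelevant outside these ranges. A decoder returns \<open>None\<close> for a declared erasure.
\<close>

record ('x, 'y) block_code =
  num_blocks :: nat
  num_msgs :: "nat \<Rightarrow> nat"
  block_len :: "nat \<Rightarrow> nat"
  encoder :: "nat \<Rightarrow> nat \<Rightarrow> 'x list"
  decoder :: "nat \<Rightarrow> 'y list \<Rightarrow> nat option"

definition block_end :: "('x, 'y) block_code \<Rightarrow> nat \<Rightarrow> nat" where
  "block_end C i = (\<Sum>j\<in>{1..i}. block_len C j)"

definition block_out :: "('x, 'y) block_code \<Rightarrow> nat \<Rightarrow> 'y list \<Rightarrow> 'y list" where
  "block_out C i ys = take (block_len C i) (drop (block_end C (i - 1)) ys)"

definition decoded :: "('x, 'y) block_code \<Rightarrow> nat \<Rightarrow> 'y list \<Rightarrow> nat option" where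
  "decoded C i ys = decoder C i (block_out C i ys)"

definition transmission_time :: "('x, 'y) block_code \<Rightarrow> nat" where
  "transmission_time C = (\<Sum>i\<in>{1..num_blocks C}. block_len C i)"

locale channel_that_dies =
  fixes p_a p_d :: "'x::finite \<Rightarrow> 'y::finite pmf"
    and p_T :: "nat pmf"
    and er :: 'y
  assumes alive_no_erasure: "pmf (p_a x) er = 0"
    and dead_erases: "p_d x = return_pmf er"
    and T_pos: "pmf p_T 0 = 0"
begin

definition valid_code :: "('x, 'y) block_code \<Rightarrow> bool" where
  "valid_code C \<longleftrightarrow> 1 \<le> num_blocks C \<and>
     (\<forall>i\<in>{1..num_blocks C}. 1 \<le> num_msgs C i \<and>
        (\<forall>w\<in>{1..num_msgs C i}. length (encoder C i w) = block_len C i) \<and>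
        (\<forall>ys. length ys = block_len C i \<longrightarrow>
           (if er \<in> set ys then decoder C i ys = None
            else decoder C i ys \<in> Some ` {1..num_msgs C i})))"

text \<open>
  The joint law of the death time \<open>T\<close>, the messages \<open>W\<close> (as a function of the block index) and the
  channel output. Messages are uniform; any other product law with full support leads to the same
  error probabilities and volume, since the former are conditioned on the message of their block
  and erasures are determined by \<open>T\<close>.
\<close>

definition transmission_law :: "('x, 'y) block_code \<Rightarrow> (nat \<times> (nat \<Rightarrow> nat) \<times> 'y list) pmf" where
  "transmission_law C = do {
     t \<leftarrow> p_T;
     w \<leftarrow> Pi_pmf {1..num_blocks C} undefined (\<lambda>i. pmf_of_set {1..num_msgs C i});
     ys \<leftarrow> channel_output (\<lambda>n. if n \<le> t then p_a else p_d)
             (concat (map (\<lambda>i. encoder C i (w i)) [1..<Suc (num_blocks C)]));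
     return_pmf (t, w, ys)
   }"

text \<open>
  When block \<open>i\<close> is almost surely erased, the conditional probability below is 0 by convention,
  so such a block does not constrain the code; it does not contribute to the volume either.
\<close>

definition error_prob :: "('x, 'y) block_code \<Rightarrow> nat \<Rightarrow> nat \<Rightarrow> real" where
  "error_prob C i w =
     \<P>((t, W, ys) in transmission_law C.
        decoded C i ys \<noteq> Some w \<bar> W i = w \<and> decoded C i ys \<noteq> None)"

definition block_max_error :: "('x, 'y) block_code \<Rightarrow> nat \<Rightarrow> real" where
  "block_max_error C i = Max (error_prob C i ` {1..num_msgs C i})"

definition max_error :: "('x, 'y) block_code \<Rightarrow> real" where
  "max_error C = Max (block_max_error C ` {1..num_blocks C})"

definition transmission_volume :: "('x, 'y) block_code \<Rightarrow> real" where
  "transmission_volume C =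
     measure_pmf.expectation (transmission_law C)
       (\<lambda>(t, W, ys). \<Sum>i | i \<in> {1..num_blocks C} \<and> decoded C i ys \<noteq> None. log 2 (real (num_msgs C i)))"

text \<open>Meant for \<open>0 \<le> \<eta> < 1\<close>, \<open>0 < N0\<close> and \<open>0 \<le> V0\<close>.\<close>

definition achievable :: "real \<Rightarrow> nat \<Rightarrow> real \<Rightarrow> bool" where
  "achievable \<eta> N0 V0 \<longleftrightarrow>
     (\<exists>C. valid_code C \<and> max_error C \<le> \<eta> \<and> transmission_time C \<le> N0 \<and> transmission_volume C \<ge> V0)"

definition shannon_achievable :: "nat \<Rightarrow> real \<Rightarrow> bool" where
  "shannon_achievable N0 V0 \<longleftrightarrow> (\<forall>\<eta>. 0 < \<eta> \<and> \<eta> < 1 \<longrightarrow> achievable \<eta> N0 V0)"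

end

end

theory Submission
  imports Defs
begin

text \<open>
  If the zero-error capacity vanishes, any two letters can produce a common output, so with
  \<open>q > 0\<close> the least positive transition probability, any two codewords of length \<open>n\<close> share an
  output word that each produces with probability at least \<open>q ^ n\<close>. A code of positive volume has
  a block with at least two messages that survives with positive probability. One of two messages
  of that block is not the decoded value of the common output word, so, conditionally on
  survival, its error probability is at least \<open>q ^ n\<close>, hence at least \<open>q ^ N\<close>.
\<close>

section \<open>Output law of a memoryless channel\<close>

lemma channel_output_length:
  assumes "ys \<in> set_pmf (channel_output p xs)"
  shows "length ys = length xs"
  using assms by (auto simp: channel_output_def)

lemma channel_output_nth:
  assumes "ys \<in> set_pmf (channel_output p xs)" "j < length xs"
  shows "ys ! j \<in> set_pmf (p (Suc j) (xs ! j))"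
  using assms by (auto simp: channel_output_def set_Pi_pmf PiE_dflt_def)

text \<open>Output letters are independent, so fixing those in a window gives a product over the
  window alone. This treats the output of one block inside the whole transmission.\<close>

lemma prob_channel_output_segment:
  assumes "m + length zs \<le> length xs"
  shows "measure_pmf.prob (channel_output p xs) {ys. take (length zs) (drop m ys) = zs} =
     (\<Prod>j<length zs. pmf (p (Suc (m + j)) (xs ! (m + j))) (zs ! j))"
proof -
  let ?n = "length zs" and ?A = "{..<length xs}"
  let ?p = "\<lambda>j. p (Suc j) (xs ! j)"
  \<comment> \<open>The event is a cylinder: one admissible letter at each position of the window,
    no constraint elsewhere, so the positions outside contribute factors 1.\<close>
  define B where "B j = (if m \<le> j \<and> j < m + ?n then {zs ! (j - m)} else UNIV)" for j
  have "(\<lambda>y. map y [0..<length xs]) -` {ys. take ?n (drop m ys) = zs} = Pi ?A B"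
  proof (intro set_eqI iffI)
    fix y assume "y \<in> (\<lambda>y. map y [0..<length xs]) -` {ys. take ?n (drop m ys) = zs}"
    then have eq: "take ?n (drop m (map y [0..<length xs])) = zs"
      by simp
    show "y \<in> Pi ?A B"
    proof
      fix j assume "j \<in> ?A"
      have "zs ! (j - m) = y j" if "m \<le> j" "j < m + ?n"
      proof -
        have "zs ! (j - m) = take ?n (drop m (map y [0..<length xs])) ! (j - m)"
          using eq by simp
        also have "\<dots> = y j"
          using that assms by simp
        finally show ?thesis .
      qed
      then show "y j \<in> B j"
        by (auto simp: B_def)
    qed
  next
    fix y assume y: "y \<in> Pi ?A B"
    have "take ?n (drop m (map y [0..<length xs])) = zs"
    proof (rule nth_equalityI)
      fix j assume "j < length (take ?n (drop m (map y [0..<length xs])))"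
      then have j: "j < ?n" by simp
      then have "y (m + j) \<in> B (m + j)"
        using Pi_mem[OF y, of "m + j"] assms by auto
      with j assms show "take ?n (drop m (map y [0..<length xs])) ! j = zs ! j"
        by (simp add: B_def)
    qed (use assms in simp)
    then show "y \<in> (\<lambda>y. map y [0..<length xs]) -` {ys. take ?n (drop m ys) = zs}"
      by simp
  qed
  then have "measure_pmf.prob (channel_output p xs) {ys. take ?n (drop m ys) = zs} =
      (\<Prod>j\<in>?A. measure_pmf.prob (?p j) (B j))"
    by (simp add: channel_output_def measure_Pi_pmf_Pi)
  also have "\<dots> = (\<Prod>j\<in>{m..<m + ?n}. measure_pmf.prob (?p j) (B j))"
    using assms by (intro prod.mono_neutral_right) (auto simp: B_def)
  also have "\<dots> = (\<Prod>j<?n. measure_pmf.prob (?p (m + j)) (B (m + j)))"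
    by (rule prod.reindex_bij_witness[of _ "\<lambda>j. m + j" "\<lambda>j. j - m"]) auto
  also have "\<dots> = (\<Prod>j<?n. pmf (?p (m + j)) (zs ! j))"
    by (intro prod.cong) (auto simp: B_def measure_pmf_single)
  finally show ?thesis .
qed

text \<open>The probability of an event under a mixture is the mean of its probabilities under the
  components, so a linear comparison valid for each component survives averaging. It serves to
  average over the death time and the messages.\<close>

lemma prob_bind_pmf_mono:
  assumes "\<And>x. x \<in> set_pmf p \<Longrightarrow>
    c * measure_pmf.prob (f x) A \<le> measure_pmf.prob (f x) B"
  shows "c * measure_pmf.prob (bind_pmf p f) A \<le> measure_pmf.prob (bind_pmf p f) B"
proof -
  have bind: "measure_pmf.prob (bind_pmf p f) S =
      measure_pmf.expectation p (\<lambda>x. measure_pmf.prob (f x) S)" for S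
    unfolding measure_pmf_bind
    by (subst measure_pmf.measure_bind[where N = "count_space UNIV"])
       (auto simp: measurable_def space_subprob_algebra intro!: prob_space_imp_subprob_space measure_pmf.prob_space_axioms)
  have int: "integrable p (\<lambda>x. measure_pmf.prob (f x) S)" for S
    by (rule measure_pmf.integrable_const_bound[where B = 1]) auto
  show ?thesis
    unfolding bind integral_mult_right_zero[symmetric]
    by (rule integral_mono_AE) (auto simp: AE_measure_pmf_iff int assms)
qed

section \<open>Common outputs from zero-error capacity zero\<close>

text \<open>Any output word that a codeword can produce decodes to its message, so the decoder maps
  the output words of length \<open>n\<close> onto a set containing all messages. This bounds the
  rates whose supremum is the capacity.\<close>

lemma zero_error_code_card:
  fixes p :: "'x \<Rightarrow> 'y::finite pmf"
  assumes "zero_error_code p M n f g"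
  shows "M \<le> CARD('y) ^ n"
proof -
  have "{1..M} \<subseteq> g ` {ys. set ys \<subseteq> UNIV \<and> length ys = n}"
  proof
    fix w assume w: "w \<in> {1..M}"
    obtain ys where ys: "ys \<in> set_pmf (channel_output (\<lambda>_. p) (f w))"
      using set_pmf_not_empty[of "channel_output (\<lambda>_. p) (f w)"] by auto
    have "\<P>(ys in channel_output (\<lambda>_. p) (f w). g ys \<noteq> w) = 0"
      using assms w by (auto simp: zero_error_code_def)
    then have "g ys = w"
      using ys by (auto simp: measure_pmf_zero_iff)
    moreover have "length ys = n"
      using channel_output_length[OF ys] assms w by (simp add: zero_error_code_def)
    ultimately show "w \<in> g ` {ys. set ys \<subseteq> UNIV \<and> length ys = n}"
      by auto
  qed
  moreover have "finite {ys :: 'y list. set ys \<subseteq> UNIV \<and> length ys = n}"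
    by (rule finite_lists_length_eq) simp
  ultimately have "card {1..M} \<le> card {ys :: 'y list. set ys \<subseteq> UNIV \<and> length ys = n}"
    by (rule surj_card_le[rotated])
  then show ?thesis
    by (subst (asm) card_lists_length_eq) auto
qed

text \<open>A real supremum dominates its members once the set is bounded above; counting output
  words bounds every rate by \<open>log 2 (real CARD('y))\<close>.\<close>

lemma zero_error_code_rate_le_capacity:
  fixes p :: "'x::finite \<Rightarrow> 'y::finite pmf"
  assumes "zero_error_code p M n f g" "1 \<le> M" "1 \<le> n"
  shows "log 2 (real M) / real n \<le> zero_error_capacity p"
  unfolding zero_error_capacity_def
proof (rule cSup_upper)
  show "log 2 (real M) / real n \<in>
      {log 2 (real M) / real n | M n. 1 \<le> M \<and> 1 \<le> n \<and> (\<exists>f g. zero_error_code p M n f g)}"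
    using assms by blast
  have "log 2 (real M) / real n \<le> log 2 (real CARD('y))"
    if "1 \<le> M" "1 \<le> n" "zero_error_code p M n f g" for M n f g
  proof -
    have "real M \<le> real CARD('y) ^ n"
      using zero_error_code_card[OF that(3)] by (metis of_nat_le_iff of_nat_power)
    then have "log 2 (real M) \<le> log 2 (real CARD('y) ^ n)"
      using that by simp
    also have "\<dots> = real n * log 2 (real CARD('y))"
      by (simp add: log_nat_power)
    finally show ?thesis
      using that by (simp add: field_simps)
  qed
  then show "bdd_above {log 2 (real M) / real n | M n.
      1 \<le> M \<and> 1 \<le> n \<and> (\<exists>f g. zero_error_code p M n f g)}"
    by (intro bdd_aboveI[of _ "log 2 (real CARD('y))"]) auto
qed

text \<open>Two letters with disjoint output supports would form a zero-error code with two messages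
  and one channel use, hence of rate 1.\<close>

lemma zero_error_capacity_zero_common_output:
  fixes p :: "'x::finite \<Rightarrow> 'y::finite pmf"
  assumes "zero_error_capacity p = 0"
  shows "set_pmf (p x) \<inter> set_pmf (p x') \<noteq> {}"
proof
  assume disj: "set_pmf (p x) \<inter> set_pmf (p x') = {}"
  define f where "f w = (if w = 1 then [x] else [x'])" for w :: nat
  \<comment> \<open>Testing the support of \<open>p x\<close> alone is enough: an output in the
    support of \<open>p x'\<close> fails the test by disjointness, and the decoder stays
    total.\<close>
  define g :: "'y list \<Rightarrow> nat" where "g ys = (if hd ys \<in> set_pmf (p x) then 1 else 2)" for ys
  have "g ys = w" if w: "w \<in> {1..2}" and ys: "ys \<in> set_pmf (channel_output (\<lambda>_. p) (f w))" for w ys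
  proof -
    have len: "length (f w) = 1"
      by (simp add: f_def)
    then have "length ys = 1"
      using channel_output_length[OF ys] by simp
    moreover have "ys ! 0 \<in> set_pmf (p (f w ! 0))"
      using channel_output_nth[OF ys, of 0] len by simp
    ultimately have "hd ys \<in> set_pmf (p (f w ! 0))"
      by (metis hd_conv_nth length_0_conv zero_neq_one)
    then show ?thesis
      using disj w by (auto simp: f_def g_def split: if_splits)
  qed
  then have "\<P>(ys in channel_output (\<lambda>_. p) (f w). g ys \<noteq> w) = 0" if "w \<in> {1..2}" for w
    using that by (auto simp: measure_pmf_zero_iff)
  then have "zero_error_code p 2 1 f g"
    unfolding zero_error_code_def by (simp add: f_def g_def)
  from zero_error_code_rate_le_capacity[OF this] assms show False
    by simp
qed

text \<open>The alphabets are finite, so the positive transition probabilities have a positive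
  minimum, and a common output of two letters has at least this probability under each of
  them.\<close>

lemma zero_error_capacity_zero_common_prob:
  fixes p :: "'x::finite \<Rightarrow> 'y::finite pmf"
  assumes "zero_error_capacity p = 0"
  obtains q where "0 < q" "q \<le> 1"
    "\<And>x x'. \<exists>y. q \<le> pmf (p x) y \<and> q \<le> pmf (p x') y"
proof -
  let ?S = "(\<lambda>(x, y). pmf (p x) y) ` (SIGMA x : UNIV. set_pmf (p x))"
  have ne: "?S \<noteq> {}"
    by (simp add: Sigma_empty_iff set_pmf_not_empty)
  have fin: "finite ?S"
    by simp
  have le: "Min ?S \<le> pmf (p x) y" if "y \<in> set_pmf (p x)" for x y
    using that by (intro Min_le fin image_eqI[of _ _ "(x, y)"]) auto
  show thesis
  proof (rule that[of "Min ?S"])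
    show "0 < Min ?S"
      using ne by (auto simp: Min_gr_iff[OF fin] pmf_positive)
    obtain y where "y \<in> set_pmf (p undefined)"
      using set_pmf_not_empty[of "p undefined"] by auto
    then show "Min ?S \<le> 1"
      by (rule order.trans[OF le pmf_le_1])
    fix x x'
    obtain y where "y \<in> set_pmf (p x)" "y \<in> set_pmf (p x')"
      using zero_error_capacity_zero_common_output[OF assms, of x x'] by auto
    then show "\<exists>y. Min ?S \<le> pmf (p x) y \<and> Min ?S \<le> pmf (p x') y"
      by (intro exI[of _ y] conjI le)
  qed
qed

section \<open>Block structure of a code and survival of blocks\<close>

context channel_that_dies
begin

lemma valid_codeD:
  assumes "valid_code C" "i \<in> {1..num_blocks C}"
  shows "1 \<le> num_msgs C i"
    and "w \<in> {1..num_msgs C i} \<Longrightarrow> length (encoder C i w) = block_len C i"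
    and "length ys = block_len C i \<Longrightarrow> er \<in> set ys \<Longrightarrow> decoder C i ys = None"
    and "length ys = block_len C i \<Longrightarrow> er \<notin> set ys \<Longrightarrow> decoder C i ys \<in> Some ` {1..num_msgs C i}"
  using assms unfolding valid_code_def by (auto split: if_splits)

abbreviation code_input :: "('x, 'y) block_code \<Rightarrow> (nat \<Rightarrow> nat) \<Rightarrow> 'x list" where
  "code_input C W \<equiv> concat (map (\<lambda>i. encoder C i (W i)) [1..<Suc (num_blocks C)])"

abbreviation message_law :: "('x, 'y) block_code \<Rightarrow> (nat \<Rightarrow> nat) pmf" where
  "message_law C \<equiv> Pi_pmf {1..num_blocks C} undefined (\<lambda>i. pmf_of_set {1..num_msgs C i})"

abbreviation output_law :: "nat \<Rightarrow> 'x list \<Rightarrow> 'y list pmf" where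
  "output_law t \<equiv> channel_output (\<lambda>n. if n \<le> t then p_a else p_d)"

lemma set_message_law:
  assumes "valid_code C"
  shows "set_pmf (message_law C) = PiE_dflt {1..num_blocks C} undefined (\<lambda>i. {1..num_msgs C i})"
proof -
  have "set_pmf (pmf_of_set {1..num_msgs C i}) = {1..num_msgs C i}" if "i \<in> {1..num_blocks C}" for i
    using valid_codeD(1)[OF assms that] by (intro set_pmf_of_set) auto
  then show ?thesis
    by (auto simp: set_Pi_pmf PiE_dflt_def)
qed

lemma block_end_pred:
  assumes "1 \<le> i"
  shows "block_end C i = block_end C (i - 1) + block_len C i"
  using assms by (cases i) (auto simp: block_end_def)

lemma length_concat_encoder:
  assumes "\<And>i. i \<in> {1..k} \<Longrightarrow> length (encoder C i (W i)) = block_len C i"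
  shows "length (concat (map (\<lambda>i. encoder C i (W i)) [1..<Suc k])) = block_end C k"
  using assms by (induction k) (auto simp: block_end_def)

lemma code_input_nth:
  assumes C: "valid_code C" and W: "W \<in> set_pmf (message_law C)" and i: "i \<in> {1..num_blocks C}"
  shows "block_end C i \<le> length (code_input C W)"
    and "j < block_len C i \<Longrightarrow> code_input C W ! (block_end C (i - 1) + j) = encoder C i (W i) ! j"
proof -
  have len: "length (encoder C j (W j)) = block_len C j" if "j \<in> {1..num_blocks C}" for j
    using W that unfolding set_message_law[OF C]
    by (intro valid_codeD(2)[OF C]) (auto simp: PiE_dflt_def)
  let ?e = "\<lambda>i. encoder C i (W i)"
  \<comment> \<open>The blocks are cut into those before \<open>i\<close>, block \<open>i\<close>
    and those after. The bound \<open>Suc (i - 1)\<close> stands for \<open>i\<close> so that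
    \<open>length_concat_encoder\<close> applies with \<open>k = i - 1\<close>.\<close>
  have "[1..<Suc (num_blocks C)] = [1..<Suc (i - 1)] @ i # [Suc i..<Suc (num_blocks C)]"
    using i upt_add_eq_append[of 1 i "Suc (num_blocks C) - i"] by (simp add: upt_conv_Cons)
  then have split: "code_input C W = concat (map ?e [1..<Suc (i - 1)]) @ ?e i @
      concat (map ?e [Suc i..<Suc (num_blocks C)])"
    by simp
  have pre: "length (concat (map ?e [1..<Suc (i - 1)])) = block_end C (i - 1)"
    using i by (intro length_concat_encoder len) auto
  show "block_end C i \<le> length (code_input C W)"
    using i block_end_pred[of i C] len[OF i] pre unfolding split by (simp del: upt_Suc)
  show "code_input C W ! (block_end C (i - 1) + j) = ?e i ! j" if "j < block_len C i"
    using that len[OF i] pre unfolding split by (simp add: nth_append del: upt_Suc)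
qed

text \<open>A block of length 0 survives whatever the death time.\<close>

lemma decoded_imp_alive:
  assumes C: "valid_code C" and W: "W \<in> set_pmf (message_law C)" and i: "i \<in> {1..num_blocks C}"
    and ys: "ys \<in> set_pmf (output_law t (code_input C W))" and dec: "decoded C i ys \<noteq> None"
  shows "block_len C i = 0 \<or> block_end C i \<le> t"
proof (rule ccontr)
  assume "\<not> ?thesis"
  then have n: "0 < block_len C i" and t: "t < block_end C i"
    by auto
  \<comment> \<open>This is the last position of the block. Positions count from 0 and times from 1,
    so its letter is sent at time \<open>block_end C i\<close>, after the death time
    \<open>t\<close>.\<close>
  let ?j = "block_end C i - 1" and ?b = "block_out C i ys"
  have be: "block_end C i = block_end C (i - 1) + block_len C i"
    using i by (intro block_end_pred) auto
  have le: "block_end C i \<le> length ys"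
    using code_input_nth(1)[OF C W i] channel_output_length[OF ys] by simp
  then have len: "length ?b = block_len C i"
    using be by (simp add: block_out_def)
  have "ys ! ?j \<in> set_pmf ((if Suc ?j \<le> t then p_a else p_d) (code_input C W ! ?j))"
    using le n be channel_output_length[OF ys] by (intro channel_output_nth[OF ys]) simp
  then have "ys ! ?j = er"
    using t by (simp add: dead_erases)
  moreover have "?b ! (block_len C i - 1) = ys ! ?j"
    using n be le by (simp add: block_out_def)
  ultimately have "er \<in> set ?b"
    using len n by (metis diff_less nth_mem zero_less_one)
  with dec valid_codeD(3)[OF C i len] show False
    by (simp add: decoded_def)
qed

section \<open>Probability of a prescribed output block\<close>

text \<open>All letters of a surviving block pass through \<open>p_a\<close>, so the probability is
  a product of \<open>block_len C i\<close> factors, each at least \<open>q\<close>; for an empty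
  block both sides are 1.\<close>

lemma block_out_prob_ge:
  assumes C: "valid_code C" and W: "W \<in> set_pmf (message_law C)" and i: "i \<in> {1..num_blocks C}"
    and zs: "length zs = block_len C i" and q: "0 \<le> q"
    and pq: "\<And>j. j < block_len C i \<Longrightarrow> q \<le> pmf (p_a (encoder C i (W i) ! j)) (zs ! j)"
    and alive: "block_len C i = 0 \<or> block_end C i \<le> t"
  shows "q ^ block_len C i \<le>
    measure_pmf.prob (output_law t (code_input C W)) {ys. block_out C i ys = zs}"
proof -
  let ?m = "block_end C (i - 1)"
  have be: "block_end C i = ?m + block_len C i"
    using i by (intro block_end_pred) auto
  have "q ^ block_len C i = (\<Prod>j<length zs. q)"
    by (simp add: zs)
  also have "\<dots> \<le> (\<Prod>j<length zs. pmf ((if Suc (?m + j) \<le> t then p_a else p_d)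
      (code_input C W ! (?m + j))) (zs ! j))"
    using alive be pq q zs code_input_nth(2)[OF C W i] by (intro prod_mono) auto
  also have "\<dots> = measure_pmf.prob (output_law t (code_input C W))
      {ys. take (length zs) (drop ?m ys) = zs}"
    using code_input_nth(1)[OF C W i] be zs by (intro prob_channel_output_segment[symmetric]) simp
  finally show ?thesis
    by (simp add: block_out_def zs)
qed

text \<open>For fixed death time and messages, either the block is alive and produces
  \<open>zs\<close> with probability at least \<open>q ^ block_len C i\<close>, or it is surely
  erased and the left side vanishes. The product form, unlike a quotient, makes sense in the second
  case and can be averaged.\<close>

lemma survival_scaled_le_block_out_prob:
  assumes C: "valid_code C" and i: "i \<in> {1..num_blocks C}"
    and zs: "length zs = block_len C i" and q: "0 \<le> q" "q \<le> 1"
    and pq: "\<And>j. j < block_len C i \<Longrightarrow> q \<le> pmf (p_a (encoder C i w ! j)) (zs ! j)"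
  shows "q ^ block_len C i *
      measure_pmf.prob (transmission_law C) {(t, W, ys). W i = w \<and> decoded C i ys \<noteq> None}
    \<le> measure_pmf.prob (transmission_law C) {(t, W, ys). W i = w \<and> block_out C i ys = zs}"
  unfolding transmission_law_def
proof (rule prob_bind_pmf_mono, rule prob_bind_pmf_mono)
  fix t W assume W: "W \<in> set_pmf (message_law C)"
  let ?o = "output_law t (code_input C W)"
  \<comment> \<open>Once \<open>t\<close> and \<open>W\<close> are fixed, the condition on the
    message is deterministic and only the channel noise remains random.\<close>
  have *: "measure_pmf.prob (bind_pmf ?o (\<lambda>ys. return_pmf (t, W, ys))) {(t, W, ys). W i = w \<and> P ys} =
      (if W i = w then measure_pmf.prob ?o {ys. P ys} else 0)" for P
    by (simp add: map_pmf_def[symmetric] vimage_def)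
  have "q ^ block_len C i * measure_pmf.prob ?o {ys. decoded C i ys \<noteq> None}
      \<le> measure_pmf.prob ?o {ys. block_out C i ys = zs}" if "W i = w"
  proof (cases "block_len C i = 0 \<or> block_end C i \<le> t")
    case True
    have "q ^ block_len C i * measure_pmf.prob ?o {ys. decoded C i ys \<noteq> None} \<le> q ^ block_len C i"
      using q by (simp add: mult_left_le)
    also have "\<dots> \<le> measure_pmf.prob ?o {ys. block_out C i ys = zs}"
      using C W i zs q(1) pq True that by (intro block_out_prob_ge) auto
    finally show ?thesis .
  next
    case False
    then have "measure_pmf.prob ?o {ys. decoded C i ys \<noteq> None} = 0"
      using decoded_imp_alive[OF C W i] by (auto simp: measure_pmf_zero_iff)
    then show ?thesis
      by simp
  qed
  then show "q ^ block_len C i * measure_pmf.prob (bind_pmf ?o (\<lambda>ys. return_pmf (t, W, ys)))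
        {(t, W, ys). W i = w \<and> decoded C i ys \<noteq> None}
      \<le> measure_pmf.prob (bind_pmf ?o (\<lambda>ys. return_pmf (t, W, ys)))
        {(t, W, ys). W i = w \<and> block_out C i ys = zs}"
    unfolding * by auto
qed

text \<open>Survival of a block is decided by the death time. One surviving outcome therefore
  supplies a good \<open>t\<close>, and the message of block \<open>i\<close> can be replaced by any
  \<open>w\<close>. This keeps the conditioning event of \<open>error_prob\<close> from being null,
  where the convention 0 would apply.\<close>

lemma block_out_prob_pos:
  assumes C: "valid_code C" and i: "i \<in> {1..num_blocks C}" and w: "w \<in> {1..num_msgs C i}"
    and zs: "length zs = block_len C i" and q: "0 < q"
    and pq: "\<And>j. j < block_len C i \<Longrightarrow> q \<le> pmf (p_a (encoder C i w ! j)) (zs ! j)"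
    and surv: "(t, W, ys) \<in> set_pmf (transmission_law C)" "decoded C i ys \<noteq> None"
  shows "0 < measure_pmf.prob (transmission_law C) {(t, W, ys). W i = w \<and> block_out C i ys = zs}"
proof -
  have t: "t \<in> set_pmf p_T" and W: "W \<in> set_pmf (message_law C)"
    and ys: "ys \<in> set_pmf (output_law t (code_input C W))"
    using surv(1) unfolding transmission_law_def by auto
  have alive: "block_len C i = 0 \<or> block_end C i \<le> t"
    using decoded_imp_alive[OF C W i ys surv(2)] .
  \<comment> \<open>Messages are independent with full support, so changing one coordinate stays in
    the support.\<close>
  let ?W = "W(i := w)"
  have W': "?W \<in> set_pmf (message_law C)"
    using W w i unfolding set_message_law[OF C] by (auto simp: PiE_dflt_def)
  have "0 < q ^ block_len C i"
    using q by simp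
  also have "\<dots> \<le> measure_pmf.prob (output_law t (code_input C ?W)) {ys. block_out C i ys = zs}"
    using q pq by (intro block_out_prob_ge[OF C W' i zs _ _ alive]) auto
  finally have "measure_pmf.prob (output_law t (code_input C ?W)) {ys. block_out C i ys = zs} \<noteq> 0"
    by simp
  then obtain ys' where "ys' \<in> set_pmf (output_law t (code_input C ?W))" "block_out C i ys' = zs"
    by (auto simp: measure_pmf_zero_iff)
  then have "(t, ?W, ys') \<in> set_pmf (transmission_law C)"
    using t W' unfolding transmission_law_def by auto
  then have "measure_pmf.prob (transmission_law C) {(t, W, ys). W i = w \<and> block_out C i ys = zs} \<noteq> 0"
    using \<open>block_out C i ys' = zs\<close> unfolding measure_pmf_zero_iff by force
  then show ?thesis
    by (simp add: zero_less_measure_iff)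
qed

section \<open>Lower bound on the error probability\<close>

text \<open>Producing \<open>zs\<close> is an error on a surviving block: the word contains no
  erasure symbol, so the decoder commits to a message, and that message is not \<open>w\<close>.
  Dividing by the positive survival probability turns the product bound into a conditional
  one.\<close>

lemma error_prob_ge:
  assumes C: "valid_code C" and i: "i \<in> {1..num_blocks C}" and w: "w \<in> {1..num_msgs C i}"
    and zs: "length zs = block_len C i" and q: "0 < q" "q \<le> 1"
    and pq: "\<And>j. j < block_len C i \<Longrightarrow> q \<le> pmf (p_a (encoder C i w ! j)) (zs ! j)"
    and surv: "(t, W, ys) \<in> set_pmf (transmission_law C)" "decoded C i ys \<noteq> None"
    and wrong: "decoder C i zs \<noteq> Some w"
  shows "q ^ block_len C i \<le> error_prob C i w"
proof -
  \<comment> \<open>Each letter of \<open>zs\<close> has probability at least \<open>q > 0\<close>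
    under \<open>p_a\<close>, which never emits \<open>er\<close>.\<close>
  have "er \<notin> set zs"
  proof
    assume "er \<in> set zs"
    then obtain j where "j < block_len C i" "zs ! j = er"
      using zs by (auto simp: in_set_conv_nth)
    then show False
      using pq[of j] q alive_no_erasure by simp
  qed
  then have some: "decoder C i zs \<noteq> None"
    using valid_codeD(4)[OF C i zs] by auto
  let ?prob = "measure_pmf.prob (transmission_law C)"
  let ?Z = "{(t, W, ys). W i = w \<and> block_out C i ys = zs}"
  let ?Q = "{(t, W, ys). W i = w \<and> decoded C i ys \<noteq> None}"
  let ?E = "{(t, W, ys). decoded C i ys \<noteq> Some w \<and> W i = w \<and> decoded C i ys \<noteq> None}"
  have ZE: "?Z \<subseteq> ?E" and EQ: "?E \<subseteq> ?Q"
    using wrong some by (auto simp: decoded_def)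
  have "0 < ?prob ?Z"
    by (rule block_out_prob_pos[OF C i w zs q(1) pq surv])
  also have "\<dots> \<le> ?prob ?Q"
    by (rule measure_pmf.finite_measure_mono[OF subset_trans[OF ZE EQ]]) simp
  finally have pos: "0 < ?prob ?Q" .
  have "q ^ block_len C i * ?prob ?Q \<le> ?prob ?Z"
    using q by (intro survival_scaled_le_block_out_prob[OF C i zs]) (auto simp: pq)
  also have "\<dots> \<le> ?prob ?E"
    by (rule measure_pmf.finite_measure_mono[OF ZE]) simp
  finally have "q ^ block_len C i \<le> ?prob ?E / ?prob ?Q"
    using pos by (simp add: field_simps)
  also have "\<dots> = error_prob C i w"
    unfolding error_prob_def cond_prob_def
    by (intro arg_cong2[where f = "(/)"] arg_cong[where f = ?prob]) auto
  finally show ?thesis .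
qed

lemma error_prob_le_max_error:
  assumes "i \<in> {1..num_blocks C}" "w \<in> {1..num_msgs C i}"
  shows "error_prob C i w \<le> max_error C"
proof -
  have "error_prob C i w \<le> block_max_error C i"
    unfolding block_max_error_def using assms by (intro Max_ge) auto
  also have "\<dots> \<le> max_error C"
    unfolding max_error_def using assms by (intro Max_ge) auto
  finally show ?thesis .
qed

text \<open>A nonzero expectation needs a possible outcome with nonzero volume, hence an unerased
  block with a nonzero logarithm; this excludes a single message.\<close>

lemma transmission_volume_posE:
  assumes C: "valid_code C" and V: "0 < transmission_volume C"
  obtains t W ys i where "(t, W, ys) \<in> set_pmf (transmission_law C)" "i \<in> {1..num_blocks C}"
    "decoded C i ys \<noteq> None" "2 \<le> num_msgs C i"
proof -
  let ?vol = "\<lambda>(t, W, ys). \<Sum>i | i \<in> {1..num_blocks C} \<and> decoded C i ys \<noteq> None.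
    log 2 (real (num_msgs C i))"
  have "\<exists>z\<in>set_pmf (transmission_law C). ?vol z \<noteq> 0"
  proof (rule ccontr)
    assume "\<not> ?thesis"
    then have "measure_pmf.expectation (transmission_law C) ?vol =
        measure_pmf.expectation (transmission_law C) (\<lambda>_. 0)"
      by (intro integral_cong_AE) (auto simp: AE_measure_pmf_iff)
    with V show False
      by (simp add: transmission_volume_def)
  qed
  then obtain t W ys where z: "(t, W, ys) \<in> set_pmf (transmission_law C)" "?vol (t, W, ys) \<noteq> 0"
    by auto
  from z(2) obtain i where i: "i \<in> {1..num_blocks C}" "decoded C i ys \<noteq> None"
    "log 2 (real (num_msgs C i)) \<noteq> 0"
    by (auto elim: sum.not_neutral_contains_not_neutral)
  have "num_msgs C i \<noteq> 1"
    using i(3) by auto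
  then have "2 \<le> num_msgs C i"
    using valid_codeD(1)[OF C i(1)] by simp
  with z(1) i show thesis
    using that by blast
qed

text \<open>The bound depends on the code only through its transmission time, so it is uniform over
  all codes of bounded duration and positive volume.\<close>

lemma max_error_ge:
  assumes q: "0 < q" "q \<le> 1" and common: "\<And>x x'. \<exists>y. q \<le> pmf (p_a x) y \<and> q \<le> pmf (p_a x') y"
    and C: "valid_code C" and V: "0 < transmission_volume C"
  shows "q ^ transmission_time C \<le> max_error C"
proof -
  from transmission_volume_posE[OF C V] obtain t W ys i where
    surv: "(t, W, ys) \<in> set_pmf (transmission_law C)" "decoded C i ys \<noteq> None"
    and i: "i \<in> {1..num_blocks C}" and M: "2 \<le> num_msgs C i"
    by metis
  obtain y where y: "\<And>x x'. q \<le> pmf (p_a x) (y x x') \<and> q \<le> pmf (p_a x') (y x x')"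
    using common by metis
  \<comment> \<open>At each position the letter is a common output of the codewords for messages 1
    and 2, so both are likely enough to produce \<open>zs\<close>.\<close>
  define zs where "zs = map (\<lambda>j. y (encoder C i 1 ! j) (encoder C i 2 ! j)) [0..<block_len C i]"
  have zs: "length zs = block_len C i"
    by (simp add: zs_def)
  \<comment> \<open>\<open>zs\<close> decodes to at most one of 1 and 2; \<open>w\<close> is one to
    which it does not decode.\<close>
  obtain w where w: "w \<in> {1, 2}" "decoder C i zs \<noteq> Some w"
    by (cases "decoder C i zs = Some 1") auto
  then have w_msg: "w \<in> {1..num_msgs C i}"
    using M by auto
  have "block_len C i \<le> transmission_time C"
    unfolding transmission_time_def using i by (intro member_le_sum) auto
  then have "q ^ transmission_time C \<le> q ^ block_len C i"
    using q by (intro power_decreasing) auto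
  also have "\<dots> \<le> error_prob C i w"
    using w y by (intro error_prob_ge[OF C i w_msg zs q _ surv w(2)]) (auto simp: zs_def)
  also have "\<dots> \<le> max_error C"
    by (rule error_prob_le_max_error[OF i w_msg])
  finally show ?thesis .
qed

end

section \<open>Choice of a reliability level out of reach\<close>

theorem proposition6:
  fixes p_a p_d :: "'x::finite \<Rightarrow> 'y::finite pmf"
    and p_T :: "nat pmf"
    and er :: 'y
  assumes "channel_that_dies p_a p_d p_T er"
    and "zero_error_capacity p_a = 0"
  shows "\<not> (\<exists>(N::nat) (V::real). 0 < N \<and> 0 < V \<and>
           channel_that_dies.shannon_achievable p_a p_d p_T er N V)"
proof
  interpret channel_that_dies p_a p_d p_T er
    by fact
  assume "\<exists>(N::nat) (V::real). 0 < N \<and> 0 < V \<and> shannon_achievable N V"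
  then obtain N :: nat and V :: real where V: "0 < V" and ach: "shannon_achievable N V"
    by blast
  obtain q where q: "0 < q" "q \<le> 1" "\<And>x x'. \<exists>y. q \<le> pmf (p_a x) y \<and> q \<le> pmf (p_a x') y"
    using zero_error_capacity_zero_common_prob[OF assms(2)] by metis
  have "0 < q ^ N" "q ^ N \<le> 1"
    using q by (auto simp: power_le_one)
  \<comment> \<open>Half of \<open>q ^ N\<close> lies in the open unit interval and strictly below
    \<open>q ^ N\<close>, which bounds from below the error of every code with time at most
    \<open>N\<close> and positive volume.\<close>
  then have "achievable (q ^ N / 2) N V"
    using ach unfolding shannon_achievable_def by auto
  then obtain C where C: "valid_code C" "max_error C \<le> q ^ N / 2" "transmission_time C \<le> N"
    "V \<le> transmission_volume C"
    unfolding achievable_def by blast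
  have "q ^ N \<le> q ^ transmission_time C"
    using q C(3) by (intro power_decreasing) auto
  also have "\<dots> \<le> max_error C"
    using C V by (intro max_error_ge q) auto
  finally show False
    using C(2) \<open>0 < q ^ N\<close> by simp
qed

end
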